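(* In the setting described in the context, let $t\in[0,T]$ and $y\in H$. Suppose that both $$\mathcal{V}(t,y)=\sup\{\mathcal{J}(t,y;\tilde u)\colon\tilde u=(u,z)\in\mathcal{U}\times\mathcal{U},\ u=z\text{ deterministic}\}$$ and $$V(t,y)=\sup\{\mathcal{J}(t,y;\tilde u)\colon\tilde u=(u,z)\in\mathcal{U}\times\mathcal{U},\ u=z\text{ deterministic}\}$$ hold true. Then a deterministic control $\tilde u^*=(u^*,u^* )\in\mathcal{U}\times\mathcal{U}$ is optimal for $\mathcal{V}(t,y)$ if and only if it is optimal for $V(t,y)$.
   Context: **Data.** $T>0$, $d>0$, $r\in\mathbb{R}$ (discount rate), $\sigma\in\mathbb{R}$; $a_0,a_1\in\mathbb{R}$; $b_0\ge0$; $b_1\in L^2([-d,0];\mathbb{R}^+)$. $W$ is a real Brownian motion on a filtered probability space $(\Omega,\mathcal{F},(\mathcal{F}_t)_{t\ge0},\mathbb{P})$, with $(\Omega,\mathcal F,\mathbb P)$ complete and the filtration being the augmentation of the one generated by $W$. $U\subset\mathbb{R}$ is a closed interval; $\mathcal{U}=L^2_{\mathcal{P}}(\Omega\times[0,T];U)$ is the space of $U$-valued square integrable progressively measurable processes; $\tilde{\mathcal{U}}=L^2_{\mathcal{P}}(\Omega\times[0,T];U)\times L^2([0,T];U)$ is the set of pairs $\tilde u=(u,z)$ with $u\in\mathcal{U}$ and $z$ deterministic. **Hilbert space and operators.** $H=\mathbb{R}^2\times L^2([-d,0],\mathbb{R}^2)$ with the product inner product; write $y=(y_0,y_1)$. Let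 $A_0=\begin{bmatrix}a_0&a_1\\0&a_0+a_1\end{bmatrix}$. The operator $Ay=(A_0y_0+y_1(0),-\dot y_1)$, with domain $\{y\in H\colon y_1\in W^{1,2}([-d,0],\mathbb{R}^2),\ y_1(-d)=0\}$, generates the $C_0$-semigroup $$e^{tA}y=\Big(e^{tA_0}y_0+\int_{-d}^0\mathbf{1}_{[-t,0]}(s)e^{(t+s)A_0}y_1(s)\,ds,\ y_1(\cdot-t)\mathbf{1}_{[-d+t,0]}(\cdot)\Big).$$ $G\colon\mathbb{R}\to H$, $Gx=((\sigma x,0),0)$; $B\colon\mathbb{R}^2\to H$, $Bq=(b_0q,b_1(\cdot)q)$. **State.** For $t\in[0,T]$, $y\in H$, $\tilde u\in\mathcal{U}\times\mathcal{U}$, $Y^{t,y,\tilde u}$ is the mild solution of $dY(s)=(AY(s)+B\tilde u(s))ds+G\,dW(s)$, $Y(t)=y$: $$Y^{t,y,\tilde u}(s)=e^{(s-t)A}y+\int_t^se^{(s-\rho)A}B\tilde u(\rho)\,d\rho+\int_t^se^{(s-\rho)A}G\,dW(\rho),\quad s\in[t,T],$$ and $Y_0^{t,y,\tilde u}$ is its $\mathbb{R}^2$-component. **Objective.** $f\colon[0,T]\times\mathbb{R}^4\to\mathbb{R}$, $(t,x,m,u,z)\mapsto f(t,x,m,u,z)$, and $g\colon\mathbb{R}^2\to\mathbb{R}$, $(x,m)\mapsto g(x,m)$, satisfy: (i) $f,g$ are measurable; (ii) there are $N>0,\ell>0,\theta>1$ with $f(t,x,m,u,z)+g(x,m)\le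 N(1+|x|+|m|+|u|+|z|)-\ell(|u|+|z|)^\theta$ for all arguments; (iii) for every $R>0$ there is a modulus of continuity $\mathtt{w}_R\colon\mathbb{R}^+\to\mathbb{R}^+$ with $$\sup_{t\in[0,T],\,u,z\in\mathbb{R}}|f(t,x,m,u,z)-f(t,x',m',u,z)|+|g(x,m)-g(x',m')|\le\mathtt{w}_R(|x-x'|+|m-m'|)$$ whenever $|x|,|m|,|x'|,|m'|\le R$. Writing $f(t,(x,m),(u,z))=f(t,x,m,u,z)$ and $g((x,m))=g(x,m)$, set $$\mathcal{J}(t,y;\tilde u)=\mathbb{E}\Big[\int_t^Te^{-r(s-t)}f\big(s,Y_0^{t,y,\tilde u}(s),\tilde u(s)\big)ds+e^{-r(T-t)}g\big(Y_0^{t,y,\tilde u}(T)\big)\Big].$$ Under these assumptions $\mathcal{J}$ is regarded as well defined (in the extended reals) for all controls considered. **Value functions.** $$\mathcal{V}(t,y)=\sup\{\mathcal{J}(t,y;\tilde u)\colon\tilde u=(u,z)\in\tilde{\mathcal{U}},\ z(s)=\mathbb{E}[u(s)]\ \forall s\in[t,T]\},$$ $$V(t,y)=\sup\{\mathcal{J}(t,y;\tilde u)\colon\tilde u=(u,z)\in\mathcal{U}\times\mathcal{U},\ u=z\}.$$ A control is optimal for $\mathcal{V}(t,y)$ (resp. $V(t,y)$) if it is admissible for the corresponding supremum and attains it. *)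

theory Defs
  imports "HOL-Probability.Probability"
begin

section \<open>The space of square integrable functions with values in the plane\<close>

text \<open>
  The type l2 below is $L^2(\mathbb{R};\mathbb{R}^2)$: Borel functions with integrable square,
  modulo equality almost everywhere. A type cannot depend on the real number $d$, so
  $L^2([-d,0];\mathbb{R}^2)$ is represented by its isometric copy, the closed subspace of the classes
  vanishing a.e. outside $[-d,0]$. The instances make the library's Bochner integral available.
\<close>

definition sq_integrable :: "(real \<Rightarrow> real^2) \<Rightarrow> bool" where
  "sq_integrable f \<longleftrightarrow> f \<in> borel_measurable lborel \<and> integrable lborel (\<lambda>x. (norm (f x))\<^sup>2)"

lemma sq_integrable_0: "sq_integrable (\<lambda>x. 0)"
  by (simp add: sq_integrable_def)

lemma sq_integrable_add:
  assumes "sq_integrable f" "sq_integrable g"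
  shows "sq_integrable (\<lambda>x. f x + g x)"
proof -
  have [measurable]: "f \<in> borel_measurable lborel" "g \<in> borel_measurable lborel"
    using assms by (auto simp: sq_integrable_def)
  have le: "(norm (f x + g x))\<^sup>2 \<le> 2 * (norm (f x))\<^sup>2 + 2 * (norm (g x))\<^sup>2" for x
  proof -
    have "(norm (f x + g x))\<^sup>2 \<le> (norm (f x) + norm (g x))\<^sup>2"
      by (intro power_mono norm_triangle_ineq) auto
    also have "\<dots> \<le> 2 * (norm (f x))\<^sup>2 + 2 * (norm (g x))\<^sup>2"
      using sum_squares_bound[of "norm (f x)" "norm (g x)"] by (simp add: power2_sum)
    finally show ?thesis .
  qed
  have "integrable lborel (\<lambda>x. 2 * (norm (f x))\<^sup>2 + 2 * (norm (g x))\<^sup>2)"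
    using assms by (auto simp: sq_integrable_def)
  then have "integrable lborel (\<lambda>x. (norm (f x + g x))\<^sup>2)"
    by (rule Bochner_Integration.integrable_bound) (measurable, rule AE_I2, use le in \<open>simp only: real_norm_def\<close>, smt (verit) le zero_le_power2)
  then show ?thesis
    by (simp add: sq_integrable_def)
qed

lemma sq_integrable_scaleR:
  assumes "sq_integrable f"
  shows "sq_integrable (\<lambda>x. c *\<^sub>R f x)"
  using assms by (auto simp: sq_integrable_def power_mult_distrib)

lemma sq_integrable_inner:
  assumes "sq_integrable f" "sq_integrable g"
  shows "integrable lborel (\<lambda>x. f x \<bullet> g x)"
proof -
  have [measurable]: "f \<in> borel_measurable lborel" "g \<in> borel_measurable lborel"
    using assms by (auto simp: sq_integrable_def)
  have 1: "integrable lborel (\<lambda>x. (norm (f x))\<^sup>2 + (norm (g x))\<^sup>2)"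
    using assms by (simp add: sq_integrable_def)
  have 2: "(\<lambda>x. f x \<bullet> g x) \<in> borel_measurable lborel"
    by measurable
  have 3: "norm (f x \<bullet> g x) \<le> norm ((norm (f x))\<^sup>2 + (norm (g x))\<^sup>2)" for x
  proof -
    have "\<bar>f x \<bullet> g x\<bar> \<le> norm (f x) * norm (g x)"
      by (rule Cauchy_Schwarz_ineq2)
    moreover have "0 \<le> norm (f x) * norm (g x)"
      by (intro mult_nonneg_nonneg norm_ge_zero)
    moreover have "2 * norm (f x) * norm (g x) \<le> (norm (f x))\<^sup>2 + (norm (g x))\<^sup>2"
      by (rule sum_squares_bound)
    ultimately show ?thesis
      unfolding real_norm_def by linarith
  qed
  show ?thesis
    by (rule Bochner_Integration.integrable_bound[OF 1 2 AE_I2]) (rule 3)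
qed

definition l2_rel :: "(real \<Rightarrow> real^2) \<Rightarrow> (real \<Rightarrow> real^2) \<Rightarrow> bool" where
  "l2_rel f g \<longleftrightarrow> sq_integrable f \<and> sq_integrable g \<and> (AE x in lborel. f x = g x)"

quotient_type l2 = "real \<Rightarrow> real^2" / partial: l2_rel
proof (rule part_equivpI)
  show "\<exists>f. l2_rel f f"
    using sq_integrable_0 by (auto simp: l2_rel_def)
  show "symp l2_rel"
    by (simp add: symp_def l2_rel_def eq_commute)
  show "transp l2_rel"
  proof (rule transpI)
    fix f g h assume fg: "l2_rel f g" and gh: "l2_rel g h"
    have "AE x in lborel. f x = g x" "AE x in lborel. g x = h x"
      using fg gh by (simp_all add: l2_rel_def)
    then have "AE x in lborel. f x = h x" by eventually_elim simp
    with fg gh show "l2_rel f h" by (simp add: l2_rel_def)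
  qed
qed

instantiation l2 :: real_inner
begin

lift_definition zero_l2 :: l2 is "\<lambda>x. 0"
  by (simp add: l2_rel_def sq_integrable_0)

lift_definition plus_l2 :: "l2 \<Rightarrow> l2 \<Rightarrow> l2" is "\<lambda>f g x. f x + g x"
  by (auto simp: l2_rel_def intro!: sq_integrable_add)

lift_definition scaleR_l2 :: "real \<Rightarrow> l2 \<Rightarrow> l2" is "\<lambda>c f x. c *\<^sub>R f x"
  by (auto simp: l2_rel_def intro!: sq_integrable_scaleR)

lift_definition inner_l2 :: "l2 \<Rightarrow> l2 \<Rightarrow> real" is "\<lambda>f g. LINT x|lborel. f x \<bullet> g x"
  by (intro integral_cong_AE) (auto simp: l2_rel_def sq_integrable_def)

definition "uminus (a :: l2) = (-1) *\<^sub>R a"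
definition "a - (b :: l2) = a + (-1) *\<^sub>R b"
definition "norm (a :: l2) = sqrt (a \<bullet> a)"
definition "dist a (b :: l2) = norm (a - b)"
definition "sgn (a :: l2) = inverse (norm a) *\<^sub>R a"
definition "(uniformity :: (l2 \<times> l2) filter) = (INF e\<in>{0 <..}. principal {(x, y). dist x y < e})"
definition "open (S :: l2 set) \<longleftrightarrow> (\<forall>x\<in>S. \<forall>\<^sub>F (x', y) in uniformity. x' = x \<longrightarrow> y \<in> S)"

instance
proof
  fix a b c :: l2 and r s :: real
  show "a + b + c = a + (b + c)"
    by transfer (simp add: l2_rel_def sq_integrable_add add.assoc)
  show "a + b = b + a"
    by transfer (simp add: l2_rel_def sq_integrable_add add.commute)
  show "0 + a = a"
    by transfer (simp add: l2_rel_def)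
  show "- a + a = 0"
    unfolding uminus_l2_def by transfer (simp add: l2_rel_def sq_integrable_0)
  show "a - b = a + - b"
    by (simp add: minus_l2_def uminus_l2_def)
  show "r *\<^sub>R (a + b) = r *\<^sub>R a + r *\<^sub>R b"
    by transfer (simp add: l2_rel_def sq_integrable_add sq_integrable_scaleR scaleR_add_right)
  show "(r + s) *\<^sub>R a = r *\<^sub>R a + s *\<^sub>R a"
    by transfer (simp add: l2_rel_def sq_integrable_add sq_integrable_scaleR scaleR_add_left)
  show "r *\<^sub>R s *\<^sub>R a = (r * s) *\<^sub>R a"
    by transfer (simp add: l2_rel_def sq_integrable_scaleR)
  show "1 *\<^sub>R a = a"
    by transfer (simp add: l2_rel_def)
  show "a \<bullet> b = b \<bullet> a"
    by transfer (simp add: inner_commute)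
  show "(a + b) \<bullet> c = a \<bullet> c + b \<bullet> c"
    by transfer (simp add: l2_rel_def inner_add_left sq_integrable_inner)
  show "r *\<^sub>R a \<bullet> b = r * (a \<bullet> b)"
    by transfer simp
  show "0 \<le> a \<bullet> a"
    by transfer simp
  show "(a \<bullet> a = 0) = (a = 0)"
  proof transfer
    fix f assume "l2_rel f f"
    then have "sq_integrable f" by (simp add: l2_rel_def)
    then have "((LINT x|lborel. f x \<bullet> f x) = 0) = (AE x in lborel. f x \<bullet> f x = 0)"
      by (intro integral_nonneg_eq_0_iff_AE sq_integrable_inner) auto
    then show "((LINT x|lborel. f x \<bullet> f x) = 0) = l2_rel f (\<lambda>x. 0)"
      using \<open>sq_integrable f\<close> by (simp add: l2_rel_def sq_integrable_0)
  qed
  show "norm a = sqrt (a \<bullet> a)" by (rule norm_l2_def)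
  show "dist a b = norm (a - b)" by (rule dist_l2_def)
  show "sgn a = inverse (norm a) *\<^sub>R a" by (rule sgn_l2_def)
  show "(uniformity :: (l2 \<times> l2) filter) = (INF e\<in>{0 <..}. principal {(x, y). dist x y < e})"
    by (rule uniformity_l2_def)
  show "open S \<longleftrightarrow> (\<forall>x\<in>S. \<forall>\<^sub>F (x', y) in uniformity. x' = x \<longrightarrow> y \<in> S)" for S :: "l2 set"
    by (rule open_l2_def)
qed

end

lemma l2_cases:
  obtains f where "sq_integrable f" "a = abs_l2 f"
proof -
  have "l2_rel (rep_l2 a) (rep_l2 a)" "abs_l2 (rep_l2 a) = a"
    using Quotient3_rep_reflp[OF Quotient3_l2] Quotient3_abs_rep[OF Quotient3_l2] by auto
  with that show thesis by (metis l2_rel_def)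
qed

lemma abs_l2_add:
  "sq_integrable f \<Longrightarrow> sq_integrable g \<Longrightarrow> abs_l2 f + abs_l2 g = abs_l2 (\<lambda>x. f x + g x)"
  by (simp add: plus_l2.abs_eq l2_rel_def)

lemma abs_l2_scaleR: "sq_integrable f \<Longrightarrow> c *\<^sub>R abs_l2 f = abs_l2 (\<lambda>x. c *\<^sub>R f x)"
  by (simp add: scaleR_l2.abs_eq l2_rel_def)

lemma abs_l2_diff:
  assumes "sq_integrable f" "sq_integrable g"
  shows "abs_l2 f - abs_l2 g = abs_l2 (\<lambda>x. f x - g x)"
proof -
  have "abs_l2 f - abs_l2 g = abs_l2 f + (-1) *\<^sub>R abs_l2 g" by simp
  also have "\<dots> = abs_l2 (\<lambda>x. f x - g x)"
    using assms sq_integrable_scaleR[of g "-1"] by (simp only: abs_l2_scaleR abs_l2_add) simp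
  finally show ?thesis .
qed

lemma sq_integrable_diff:
  assumes "sq_integrable f" "sq_integrable g" shows "sq_integrable (\<lambda>x. f x - g x)"
  using sq_integrable_add[OF assms(1) sq_integrable_scaleR[OF assms(2), of "-1"]] by simp

lemma norm_abs_l2: "sq_integrable f \<Longrightarrow> norm (abs_l2 f) = sqrt (LINT x|lborel. (norm (f x))\<^sup>2)"
  by (simp add: norm_eq_sqrt_inner inner_l2.abs_eq l2_rel_def power2_norm_eq_inner)

lemma sq_integrable_indicator:
  assumes "A \<in> sets lborel" "emeasure lborel A < \<infinity>"
  shows "sq_integrable (\<lambda>x. indicator A x *\<^sub>R c)"
proof -
  have "(\<lambda>x. (norm (indicator A x *\<^sub>R c))\<^sup>2) = (\<lambda>x. indicator A x *\<^sub>R (norm c)\<^sup>2)"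
    by (auto simp: indicator_def)
  then show ?thesis using assms by (auto simp: sq_integrable_def)
qed

lemma norm_indicator_l2:
  assumes "A \<in> sets lborel" "emeasure lborel A < \<infinity>"
  shows "norm (abs_l2 (\<lambda>x. indicator A x *\<^sub>R c)) = sqrt (measure lborel A) * norm c"
proof -
  have eq: "(\<lambda>x. (norm (indicator A x *\<^sub>R c))\<^sup>2) = (\<lambda>x. indicator A x *\<^sub>R (norm c)\<^sup>2)"
    by (auto simp: indicator_def)
  have "(LINT x|lborel. indicator A x *\<^sub>R (norm c)\<^sup>2) = measure lborel A * (norm c)\<^sup>2"
    using assms by simp
  then show ?thesis
    unfolding norm_abs_l2[OF sq_integrable_indicator[OF assms]] eq
    by (simp add: real_sqrt_mult)
qed

lemma finite_measure_approx_countable: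
  "\<exists>\<B> :: real set set. countable \<B> \<and> \<B> \<subseteq> sets lborel \<and>
    (\<forall>A e. A \<in> sets lborel \<longrightarrow> emeasure lborel A < \<infinity> \<longrightarrow> e > 0 \<longrightarrow>
      (\<exists>B\<in>\<B>. emeasure lborel B < \<infinity> \<and> measure lborel (A - B) + measure lborel (B - A) < e))"
proof -
  obtain \<C> :: "real set set" where C: "countable \<C>" "\<And>C. C \<in> \<C> \<Longrightarrow> open C"
    "\<And>S. open S \<Longrightarrow> \<exists>U. U \<subseteq> \<C> \<and> S = \<Union>U"
    by (rule univ_second_countable) blast
  define \<B> where "\<B> = Union ` {F. finite F \<and> F \<subseteq> \<C>}"
  have "countable {F. finite F \<and> F \<subseteq> \<C>}"
    using C(1) by (rule countable_Collect_finite_subset)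
  then have 1: "countable \<B>" by (simp add: \<B>_def)
  have opn: "open B" if "B \<in> \<B>" for B
    using that C(2) by (auto simp: \<B>_def)
  have 2: "B \<in> sets lborel" if "B \<in> \<B>" for B
    using opn[OF that] by simp
  have 3: "\<exists>B\<in>\<B>. emeasure lborel B < \<infinity> \<and> measure lborel (A - B) + measure lborel (B - A) < e"
    if A: "A \<in> sets lborel" "emeasure lborel A < \<infinity>" and e: "e > 0" for A and e :: real
  proof -
    have "A \<in> sets lebesgue" using A(1) by (simp add: sets_completionI_sets)
    then obtain S where S: "open S" "A \<subseteq> S" "(S - A) \<in> lmeasurable"
      "emeasure lebesgue (S - A) < ennreal (e/2)"
      using sets_lebesgue_outer_open[of A "e/2"] e by auto
    have Sm: "S \<in> sets lborel" using S(1) by simp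
    have d: "emeasure lborel (S - A) < ennreal (e/2)"
      using S(4) A Sm by (simp add: emeasure_completion)
    have Sfin: "emeasure lborel S < \<infinity>"
    proof -
      have "emeasure lborel S \<le> emeasure lborel A + emeasure lborel (S - A)"
        using emeasure_subadditive[of A lborel "S - A"] A Sm S(2)
        by (metis Diff_partition sets.Diff)
      also have "\<dots> < \<infinity>" using A d by (auto simp: less_top[symmetric])
      finally show ?thesis .
    qed
    obtain U where U: "U \<subseteq> \<C>" "S = \<Union>U" using C(3)[OF S(1)] by blast
    have "countable U" using U(1) C(1) countable_subset by blast
    then obtain h :: "nat \<Rightarrow> real set" where h: "U = {} \<or> U = range h"
      by (metis range_from_nat_into)
    define G where "G n = (if U = {} then {} else \<Union>(h ` {..n}))" for n
    have GB: "G n \<in> \<B>" for n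
    proof (cases "U = {}")
      case True
      then show ?thesis by (auto simp: G_def \<B>_def intro!: image_eqI[where x="{}"])
    next
      case False
      then have "h ` {..n} \<subseteq> \<C>" using h U(1) by auto
      with False show ?thesis
        by (auto simp: G_def \<B>_def intro!: image_eqI[where x="h ` {..n}"])
    qed
    have "incseq G" by (auto simp: incseq_def G_def dest: order_trans)
    have UG: "(\<Union>n. G n) = S" unfolding G_def U(2) using h by (cases "U = {}") auto
    have "(\<lambda>n. measure lborel (G n)) \<longlonglongrightarrow> measure lborel (\<Union>n. G n)"
      by (rule Lim_measure_incseq)
         (use 2[OF GB] \<open>incseq G\<close> Sfin UG in \<open>auto simp: less_top[symmetric]\<close>)
    then have "\<forall>\<^sub>F n in sequentially. dist (measure lborel (G n)) (measure lborel S) < e/2"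
      unfolding UG using e by (intro tendstoD) auto
    then obtain n where n: "dist (measure lborel (G n)) (measure lborel S) < e/2"
      using eventually_happens'[OF sequentially_bot] by blast
    have GS: "G n \<subseteq> S" using UG by auto
    have Gm: "G n \<in> sets lborel" using 2[OF GB] .
    have Gfin: "emeasure lborel (G n) < \<infinity>"
      using emeasure_mono[OF GS Sm] Sfin by (meson le_less_trans)
    have "measure lborel (S - G n) = measure lborel S - measure lborel (G n)"
      using measure_Diff[of lborel S "G n"] Sfin Sm Gm GS by (auto simp: less_top[symmetric])
    then have a: "measure lborel (S - G n) < e/2"
      using n unfolding dist_real_def by linarith
    have fin1: "emeasure lborel (S - G n) < \<infinity>"
      using emeasure_mono[of "S - G n" S lborel] Sm Sfin by (meson Diff_subset le_less_trans)
    have fin2: "emeasure lborel (S - A) < \<infinity>"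
      using less_trans[OF d ennreal_less_top] by simp
    have "measure lborel (A - G n) \<le> measure lborel (S - G n)"
      by (rule measure_mono_fmeasurable) (use S(2) A Gm Sm fin1 in \<open>auto simp: fmeasurable_def\<close>)
    moreover have "measure lborel (G n - A) \<le> measure lborel (S - A)"
      by (rule measure_mono_fmeasurable) (use GS A Gm Sm fin2 in \<open>auto simp: fmeasurable_def\<close>)
    moreover have "measure lborel (S - A) < e/2"
      using d e fin2 by (simp add: emeasure_eq_ennreal_measure ennreal_less_iff less_top)
    ultimately show ?thesis using a GB[of n] Gfin by (intro bexI[of _ "G n"]) auto
  qed
  show ?thesis
    by (intro exI[of _ \<B>] conjI allI impI 1 3) (use 2 in auto)
qed

lemma l2_countable_dense: "\<exists>D :: l2 set. countable D \<and> closure D = UNIV"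
proof -
  obtain \<B> :: "real set set" where cB: "countable \<B>"
    and mB: "\<And>B. B \<in> \<B> \<Longrightarrow> B \<in> sets lborel"
    and aB: "\<And>A e. A \<in> sets lborel \<Longrightarrow> emeasure lborel A < \<infinity> \<Longrightarrow> e > 0 \<Longrightarrow>
      \<exists>B\<in>\<B>. emeasure lborel B < \<infinity> \<and> measure lborel (A - B) + measure lborel (B - A) < e"
    using finite_measure_approx_countable by (metis (no_types, lifting) subsetD)
  obtain Q :: "(real^2) set" where cQ: "countable Q"
    and Q: "\<And>X. open X \<Longrightarrow> X \<noteq> {} \<Longrightarrow> \<exists>d\<in>Q. d \<in> X"
    by (erule countable_dense_setE)
  define ind where "ind = (\<lambda>(q :: real^2, B). abs_l2 (\<lambda>x. indicator B x *\<^sub>R q))"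
  define K where "K = Q \<times> {B \<in> \<B>. emeasure lborel B < \<infinity>}"
  define D where "D = (\<lambda>l. sum_list (map ind l)) ` lists K"
  have "countable D"
    unfolding D_def K_def using cQ cB by (intro countable_image countable_lists countable_SIGMA) auto
  have zD: "0 \<in> closure D"
    using closure_subset[of D] by (auto simp: D_def intro!: image_eqI[where x="[]"])
  have addD: "a + b \<in> closure D" if ab: "a \<in> closure D" "b \<in> closure D" for a b
  proof -
    obtain f where f: "\<And>n. f n \<in> D" "f \<longlonglongrightarrow> a"
      using ab(1) by (auto simp: closure_sequential)
    obtain g where g: "\<And>n. g n \<in> D" "g \<longlonglongrightarrow> b"
      using ab(2) by (auto simp: closure_sequential)
    have "x + y \<in> D" if xy: "x \<in> D" "y \<in> D" for x y
    proof -
      obtain l l' where "l \<in> lists K" "x = sum_list (map ind l)"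
        "l' \<in> lists K" "y = sum_list (map ind l')"
        using xy by (auto simp: D_def)
      then show ?thesis
        by (auto simp: D_def intro!: image_eqI[where x="l @ l'"])
    qed
    with f g show ?thesis
      by (auto simp: closure_sequential intro!: exI[of _ "\<lambda>n. f n + g n"] tendsto_add)
  qed
  have indD: "abs_l2 (\<lambda>x. indicator A x *\<^sub>R c) \<in> closure D"
    if A: "A \<in> sets lborel" "emeasure lborel A < \<infinity>" for A and c :: "real^2"
    unfolding closure_approachable
  proof (intro allI impI)
    fix e :: real assume e: "e > 0"
    define \<delta> where "\<delta> = (e / (2 * (norm c + 1)))\<^sup>2"
    have "norm c + 1 > 0" by (simp add: add_nonneg_pos)
    then have "\<delta> > 0" using e by (auto simp: \<delta>_def)
    then obtain B where B: "B \<in> \<B>" "emeasure lborel B < \<infinity>"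
      "measure lborel (A - B) + measure lborel (B - A) < \<delta>"
      using aB[OF A] by blast
    have Bm: "B \<in> sets lborel" using mB B by auto
    define \<eta> where "\<eta> = e / (2 * (sqrt (measure lborel B) + 1))"
    have pos: "sqrt (measure lborel B) + 1 > 0" by (simp add: add_nonneg_pos)
    then have "\<eta> > 0" using e by (auto simp: \<eta>_def)
    then obtain q where q: "q \<in> Q" "dist c q < \<eta>"
      using Q[of "ball c \<eta>"] by auto
    have sA: "sq_integrable (\<lambda>x. indicator A x *\<^sub>R c)" by (rule sq_integrable_indicator[OF A])
    have sB: "sq_integrable (\<lambda>x. indicator B x *\<^sub>R k)" for k :: "real^2"
      by (rule sq_integrable_indicator[OF Bm B(2)])
    have "norm (abs_l2 (\<lambda>x. indicator A x *\<^sub>R c) - abs_l2 (\<lambda>x. indicator B x *\<^sub>R c)) < e/2"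
    proof -
      let ?S = "(A - B) \<union> (B - A)"
      have "(norm (indicator A x *\<^sub>R c - indicator B x *\<^sub>R c))\<^sup>2 = indicator ?S x *\<^sub>R (norm c)\<^sup>2" for x
        by (auto simp: indicator_def)
      then have "norm (abs_l2 (\<lambda>x. indicator A x *\<^sub>R c) - abs_l2 (\<lambda>x. indicator B x *\<^sub>R c))
        = sqrt (LINT x|lborel. indicator ?S x *\<^sub>R (norm c)\<^sup>2)"
        by (simp add: abs_l2_diff[OF sA sB] norm_abs_l2[OF sq_integrable_diff[OF sA sB]])
      also have "emeasure lborel ?S < \<infinity>"
      proof -
        have "emeasure lborel ?S \<le> emeasure lborel (A \<union> B)" using A Bm by (intro emeasure_mono) auto
        also have "\<dots> \<le> emeasure lborel A + emeasure lborel B" using A Bm by (intro emeasure_subadditive) auto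
        also have "\<dots> < \<infinity>" using A B by (auto simp: less_top[symmetric])
        finally show ?thesis .
      qed
      then have "(LINT x|lborel. indicator ?S x *\<^sub>R (norm c)\<^sup>2) = measure lborel ?S * (norm c)\<^sup>2"
        using A Bm by simp
      also have "measure lborel ?S \<le> measure lborel (A - B) + measure lborel (B - A)"
        using A Bm by (intro measure_Un_le) auto
      then have "sqrt (measure lborel ?S * (norm c)\<^sup>2) \<le> sqrt (\<delta> * (norm c)\<^sup>2)"
        using B(3) by (intro real_sqrt_le_mono mult_right_mono) auto
      also have "\<dots> = e/2 * (norm c / (norm c + 1))"
        using e \<open>norm c + 1 > 0\<close> by (simp add: real_sqrt_mult \<delta>_def)
      also have "\<dots> < e/2 * 1"
        using e \<open>norm c + 1 > 0\<close> by (intro mult_strict_left_mono) auto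
      finally show ?thesis by simp
    qed
    moreover have "norm (abs_l2 (\<lambda>x. indicator B x *\<^sub>R c) - abs_l2 (\<lambda>x. indicator B x *\<^sub>R q)) < e/2"
    proof -
      have "norm (abs_l2 (\<lambda>x. indicator B x *\<^sub>R c) - abs_l2 (\<lambda>x. indicator B x *\<^sub>R q))
        = sqrt (measure lborel B) * norm (c - q)"
        using norm_indicator_l2[OF Bm B(2), of "c - q"]
        by (simp add: abs_l2_diff[OF sB sB] scaleR_diff_right)
      also have "\<dots> \<le> sqrt (measure lborel B) * \<eta>"
        using q(2) by (intro mult_left_mono) (auto simp: dist_norm)
      also have "\<dots> < (sqrt (measure lborel B) + 1) * \<eta>" using \<open>\<eta> > 0\<close> by simp
      also have "\<dots> = e/2"
      proof -
        have "w * (e / (2 * w)) = e/2" if "w > 0" for w :: real using that by simp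
        from this[OF pos] show ?thesis by (simp only: \<eta>_def)
      qed
      finally show ?thesis .
    qed
    ultimately have "dist (ind (q, B)) (abs_l2 (\<lambda>x. indicator A x *\<^sub>R c)) < e"
      using dist_triangle_half_r[of "abs_l2 (\<lambda>x. indicator B x *\<^sub>R c)" "abs_l2 (\<lambda>x. indicator B x *\<^sub>R q)" e
          "abs_l2 (\<lambda>x. indicator A x *\<^sub>R c)"]
      by (simp add: ind_def dist_norm norm_minus_commute)
    moreover have "ind (q, B) \<in> D"
      using q B by (auto simp: D_def K_def intro!: image_eqI[where x="[(q, B)]"])
    ultimately show "\<exists>y\<in>D. dist y (abs_l2 (\<lambda>x. indicator A x *\<^sub>R c)) < e" by blast
  qed
  have sumD: "sq_integrable (\<lambda>x. \<Sum>y\<in>Y. indicator (A y) x *\<^sub>R y) \<and>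
      abs_l2 (\<lambda>x. \<Sum>y\<in>Y. indicator (A y) x *\<^sub>R y) \<in> closure D"
    if "finite Y" "\<And>y. y \<in> Y \<Longrightarrow> A y \<in> sets lborel \<and> emeasure lborel (A y) < \<infinity>"
    for Y :: "(real^2) set" and A
    using that
  proof (induction Y)
    case empty
    have "abs_l2 (\<lambda>x. 0) = 0" by (simp add: zero_l2_def)
    then show ?case using zD by (simp add: sq_integrable_0)
  next
    case (insert y Y)
    then have A: "A y \<in> sets lborel" "emeasure lborel (A y) < \<infinity>"
      and IH: "sq_integrable (\<lambda>x. \<Sum>y\<in>Y. indicator (A y) x *\<^sub>R y)"
        "abs_l2 (\<lambda>x. \<Sum>y\<in>Y. indicator (A y) x *\<^sub>R y) \<in> closure D"
      by blast+
    have sy: "sq_integrable (\<lambda>x. indicator (A y) x *\<^sub>R y)"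
      by (rule sq_integrable_indicator[OF A])
    show ?case
      unfolding sum.insert[OF insert(1,2)]
      using sq_integrable_add[OF sy IH(1)] addD[OF indD[OF A] IH(2)] abs_l2_add[OF sy IH(1)]
      by metis
  qed
  have "a \<in> closure D" for a
  proof -
    obtain f where f: "sq_integrable f" "a = abs_l2 f" by (rule l2_cases)
    have fm [measurable]: "f \<in> borel_measurable lborel" and fi: "integrable lborel (\<lambda>x. (norm (f x))\<^sup>2)"
      using f by (auto simp: sq_integrable_def)
    obtain s where s: "\<And>i. simple_function lborel (s i)" "\<And>x. (\<lambda>i. s i x) \<longlonglongrightarrow> f x"
      "\<And>i x. norm (s i x) \<le> 2 * norm (f x)"
      using borel_measurable_implies_sequence_metric[OF fm, of 0] by auto
    have sm [measurable]: "s i \<in> borel_measurable lborel" for i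
      using s(1) by (rule borel_measurable_simple_function)
    have ssq: "(norm (s i x))\<^sup>2 \<le> 4 * (norm (f x))\<^sup>2" for i x
      using power_mono[OF s(3)[of i x], of 2] by (simp add: power_mult_distrib)
    have f4: "integrable lborel (\<lambda>x. 4 * (norm (f x))\<^sup>2)" using fi by simp
    have ssi: "sq_integrable (s i)" for i
      unfolding sq_integrable_def
      using Bochner_Integration.integrable_bound[OF f4, of "\<lambda>x. (norm (s i x))\<^sup>2"] ssq by auto
    have sD: "abs_l2 (s i) \<in> closure D" for i
    proof -
      let ?Y = "range (s i) - {0}"
      have fY: "finite ?Y" using s(1)[of i] by (simp add: simple_function_def)
      have fin: "s i -` {y} \<in> sets lborel \<and> emeasure lborel (s i -` {y}) < \<infinity>" if "y \<in> ?Y" for y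
      proof
        show m: "s i -` {y} \<in> sets lborel"
          using measurable_sets[OF sm[of i], of "{y}"] by simp
        have "integrable lborel (\<lambda>x. (norm (s i x))\<^sup>2 / (norm y)\<^sup>2)"
          using ssi[of i] by (simp add: sq_integrable_def)
        then have "integrable lborel (indicator (s i -` {y}) :: real \<Rightarrow> real)"
          by (rule Bochner_Integration.integrable_bound)
             (use m that in \<open>auto simp: indicator_def\<close>)
        then show "emeasure lborel (s i -` {y}) < \<infinity>"
          using m by (simp add: integrable_indicator_iff)
      qed
      have "s i x = (\<Sum>y\<in>?Y. indicator (s i -` {y}) x *\<^sub>R y)" for x
      proof (cases "s i x = 0")
        case True
        have "(\<Sum>y\<in>?Y. indicator (s i -` {y}) x *\<^sub>R y) = 0"
          using True by (intro sum.neutral) (auto simp: indicator_def)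
        with True show ?thesis by simp
      next
        case False
        then have "(\<Sum>y\<in>?Y. indicator (s i -` {y}) x *\<^sub>R y) = (\<Sum>y\<in>{s i x}. indicator (s i -` {y}) x *\<^sub>R y)"
          using fY by (intro sum.mono_neutral_right) (auto simp: indicator_def)
        then show ?thesis by simp
      qed
      then have "s i = (\<lambda>x. \<Sum>y\<in>?Y. indicator (s i -` {y}) x *\<^sub>R y)"
        by (rule ext)
      then have "abs_l2 (s i) = abs_l2 (\<lambda>x. \<Sum>y\<in>?Y. indicator (s i -` {y}) x *\<^sub>R y)"
        by (rule arg_cong[where f=abs_l2])
      then show ?thesis
        using sumD[OF fY, of "\<lambda>y. s i -` {y}"] fin by (simp only:)
    qed
    have "(\<lambda>i. LINT x|lborel. (norm (s i x - f x))\<^sup>2) \<longlonglongrightarrow> (LINT (x::real)|lborel. (0 :: real))"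
    proof (rule integral_dominated_convergence[where w="\<lambda>x. 9 * (norm (f x))\<^sup>2"])
      show "integrable lborel (\<lambda>x. 9 * (norm (f x))\<^sup>2)"
        using fi by simp
      show "AE x in lborel. (\<lambda>i. (norm (s i x - f x))\<^sup>2) \<longlonglongrightarrow> 0"
      proof (rule AE_I2)
        fix x
        have "(\<lambda>i. (norm (s i x - f x))\<^sup>2) \<longlonglongrightarrow> (norm (f x - f x))\<^sup>2"
          using s(2) by (intro tendsto_intros)
        then show "(\<lambda>i. (norm (s i x - f x))\<^sup>2) \<longlonglongrightarrow> 0" by simp
      qed
      show "AE x in lborel. norm ((norm (s i x - f x))\<^sup>2) \<le> 9 * (norm (f x))\<^sup>2" for i
      proof (rule AE_I2)
        fix x
        have "norm (s i x - f x) \<le> 3 * norm (f x)"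
          using norm_triangle_ineq4[of "s i x" "f x"] s(3)[of i x] by linarith
        from power_mono[OF this, of 2] show "norm ((norm (s i x - f x))\<^sup>2) \<le> 9 * (norm (f x))\<^sup>2"
          by (simp add: power_mult_distrib)
      qed
    qed auto
    then have "(\<lambda>i. sqrt (LINT x|lborel. (norm (s i x - f x))\<^sup>2)) \<longlonglongrightarrow> 0"
      using tendsto_real_sqrt[of _ 0] by simp
    then have "(\<lambda>i. norm (abs_l2 (s i) - abs_l2 f)) \<longlonglongrightarrow> 0"
      by (simp only: abs_l2_diff[OF ssi f(1)] norm_abs_l2[OF sq_integrable_diff[OF ssi f(1)]])
    then have "(\<lambda>i. abs_l2 (s i)) \<longlonglongrightarrow> a"
      unfolding f(2) by (simp only: tendsto_norm_zero_iff LIM_zero_iff)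
    then show ?thesis
      by (rule closed_sequentially[OF closed_closure sD])
  qed
  with \<open>countable D\<close> show ?thesis by blast
qed

instance l2 :: second_countable_topology
proof
  obtain D :: "l2 set" where D: "countable D" "closure D = UNIV"
    using l2_countable_dense by blast
  define B where "B = (\<lambda>(d, n). ball d (inverse (real (Suc n)))) ` (D \<times> UNIV)"
  have "countable B" unfolding B_def using D(1) by auto
  moreover have "topological_basis B"
  proof (rule topological_basisI)
    show "open S" if "S \<in> B" for S using that by (auto simp: B_def)
  next
    fix S :: "l2 set" and x assume "open S" "x \<in> S"
    then obtain e where e: "e > 0" "ball x e \<subseteq> S" by (auto simp: open_contains_ball)
    obtain n where n: "inverse (real (Suc n)) < e/2" using e(1) reals_Archimedean[of "e/2"] by auto
    obtain d where d: "d \<in> D" "dist d x < inverse (real (Suc n))"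
      using D(2) closure_approachable[of x D]
      by (metis UNIV_I inverse_positive_iff_positive of_nat_0_less_iff zero_less_Suc)
    have "ball d (inverse (real (Suc n))) \<subseteq> ball x e"
    proof
      fix z assume "z \<in> ball d (inverse (real (Suc n)))"
      then have "dist d z < inverse (real (Suc n))" by simp
      with d n dist_triangle[of x z d] show "z \<in> ball x e"
        by (simp add: dist_commute)
    qed
    with d e show "\<exists>B'\<in>B. x \<in> B' \<and> B' \<subseteq> S"
      unfolding B_def by (intro bexI[of _ "ball d (inverse (real (Suc n)))"]) (auto simp: image_iff)
  qed
  ultimately show "\<exists>B :: l2 set set. countable B \<and> open = generate_topology B"
    using topological_basis_imp_subbasis by blast
qed


section \<open>Data and standing assumptions\<close>

record 'a control_problem =
  prob :: "'a measure"                                    \<comment> \<open>$(\Omega,\mathcal{F},\mathbb{P})$\<close>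
  bm :: "real \<Rightarrow> 'a \<Rightarrow> real"                             \<comment> \<open>$W$\<close>
  horizon :: real                                         \<comment> \<open>$T$\<close>
  delay :: real                                           \<comment> \<open>$d$\<close>
  discount :: real                                        \<comment> \<open>$r$\<close>
  vol :: real                                             \<comment> \<open>$\sigma$\<close>
  coef_a0 :: real
  coef_a1 :: real
  coef_b0 :: real
  coef_b1 :: "real \<Rightarrow> real"
  ctrl_set :: "real set"                                  \<comment> \<open>$U$\<close>
  running :: "real \<Rightarrow> real \<Rightarrow> real \<Rightarrow> real \<Rightarrow> real \<Rightarrow> real"   \<comment> \<open>$f(t,x,m,u,z)$\<close>
  terminal :: "real \<Rightarrow> real \<Rightarrow> real"                       \<comment> \<open>$g(x,m)$\<close>

definition aug_filtration :: "'a measure \<Rightarrow> (real \<Rightarrow> 'a \<Rightarrow> real) \<Rightarrow> real \<Rightarrow> 'a measure" where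
  "aug_filtration M W t =
     sigma (space M) ((\<Union>s\<in>{0..t}. {W s -` B \<inter> space M | B. B \<in> sets borel}) \<union> null_sets M)"

definition brownian_motion :: "'a measure \<Rightarrow> (real \<Rightarrow> 'a measure) \<Rightarrow> (real \<Rightarrow> 'a \<Rightarrow> real) \<Rightarrow> bool" where
  "brownian_motion M F W \<longleftrightarrow>
     (\<forall>s\<ge>0. W s \<in> borel_measurable (F s)) \<and>
     (AE \<omega> in M. W 0 \<omega> = 0) \<and>
     (AE \<omega> in M. continuous_on {0..} (\<lambda>s. W s \<omega>)) \<and>
     (\<forall>s t. 0 \<le> s \<and> s < t \<longrightarrow>
        distributed M lborel (\<lambda>\<omega>. W t \<omega> - W s \<omega>) (normal_density 0 (sqrt (t - s))) \<and>
        prob_space.indep_set M (sets (F s))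
          (sets (vimage_algebra (space M) (\<lambda>\<omega>. W t \<omega> - W s \<omega>) borel)))"

definition rewards_measurable :: "'a control_problem \<Rightarrow> bool" where
  "rewards_measurable P \<longleftrightarrow>
     (\<lambda>(t, x, m, u, z). running P t x m u z)
        \<in> borel_measurable (restrict_space borel ({0..horizon P} \<times> UNIV)) \<and>
     (\<lambda>(x, m). terminal P x m) \<in> borel_measurable borel"

definition rewards_growth :: "'a control_problem \<Rightarrow> bool" where
  "rewards_growth P \<longleftrightarrow>
     (\<exists>N>0. \<exists>l>0. \<exists>\<theta>>1. \<forall>t\<in>{0..horizon P}. \<forall>x m u z.
        running P t x m u z + terminal P x m
          \<le> N * (1 + \<bar>x\<bar> + \<bar>m\<bar> + \<bar>u\<bar> + \<bar>z\<bar>) - l * (\<bar>u\<bar> + \<bar>z\<bar>) powr \<theta>)"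

definition modulus_of_continuity :: "(real \<Rightarrow> real) \<Rightarrow> bool" where
  "modulus_of_continuity w \<longleftrightarrow> (\<forall>\<delta>\<ge>0. 0 \<le> w \<delta>) \<and> w 0 = 0 \<and> (w \<longlongrightarrow> 0) (at_right 0)"

definition rewards_locally_uniform :: "'a control_problem \<Rightarrow> bool" where
  "rewards_locally_uniform P \<longleftrightarrow>
     (\<forall>R>0. \<exists>w. modulus_of_continuity w \<and>
        (\<forall>x m x' m'. \<bar>x\<bar> \<le> R \<and> \<bar>m\<bar> \<le> R \<and> \<bar>x'\<bar> \<le> R \<and> \<bar>m'\<bar> \<le> R \<longrightarrow>
           (SUP (t, u, z)\<in>{0..horizon P} \<times> UNIV \<times> UNIV.
              ereal \<bar>running P t x m u z - running P t x' m' u z\<bar>)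
             + ereal \<bar>terminal P x m - terminal P x' m'\<bar>
           \<le> ereal (w (\<bar>x - x'\<bar> + \<bar>m - m'\<bar>))))"

definition standing_assumptions :: "'a control_problem \<Rightarrow> bool" where
  "standing_assumptions P \<longleftrightarrow>
     prob_space (prob P) \<and> complete_measure (prob P) \<and>
     brownian_motion (prob P) (aug_filtration (prob P) (bm P)) (bm P) \<and>
     0 < horizon P \<and> 0 < delay P \<and> 0 \<le> coef_b0 P \<and>
     set_borel_measurable lborel {- delay P..0} (coef_b1 P) \<and>
     (\<forall>\<xi>\<in>{- delay P..0}. 0 \<le> coef_b1 P \<xi>) \<and>
     set_integrable lborel {- delay P..0} (\<lambda>\<xi>. (coef_b1 P \<xi>)\<^sup>2) \<and>
     closed (ctrl_set P) \<and> is_interval (ctrl_set P) \<and>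
     rewards_measurable P \<and> rewards_growth P \<and> rewards_locally_uniform P"


section \<open>Controls\<close>

text \<open>
  Elements of the $L^2$ spaces of controls are represented by functions; as usual, two functions are
  the same control if they agree $dt \otimes \mathbb{P}$-a.e. on $[0,T] \times \Omega$.
\<close>

type_synonym 'a process = "real \<Rightarrow> 'a \<Rightarrow> real"

definition time_prob :: "'a control_problem \<Rightarrow> (real \<times> 'a) measure" where
  "time_prob P = restrict_space lborel {0..horizon P} \<Otimes>\<^sub>M prob P"

definition same_control :: "'a control_problem \<Rightarrow> 'a process \<Rightarrow> 'a process \<Rightarrow> bool" where
  "same_control P u v \<longleftrightarrow> (AE (s, \<omega>) in time_prob P. u s \<omega> = v s \<omega>)"

definition progressively_measurable :: "(real \<Rightarrow> 'a measure) \<Rightarrow> real \<Rightarrow> 'a process \<Rightarrow> bool" where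
  "progressively_measurable F T u \<longleftrightarrow>
     (\<forall>s\<in>{0..T}. (\<lambda>(\<rho>, \<omega>). u \<rho> \<omega>) \<in> borel_measurable (restrict_space borel {0..s} \<Otimes>\<^sub>M F s))"

text \<open>$\mathcal{U} = L^2_{\mathcal{P}}(\Omega \times [0,T]; U)$ and $L^2([0,T]; U)$\<close>

definition controls :: "'a control_problem \<Rightarrow> 'a process set" where
  "controls P = {u. progressively_measurable (aug_filtration (prob P) (bm P)) (horizon P) u \<and>
     (\<forall>s\<in>{0..horizon P}. \<forall>\<omega>\<in>space (prob P). u s \<omega> \<in> ctrl_set P) \<and>
     integrable (time_prob P) (\<lambda>(s, \<omega>). (u s \<omega>)\<^sup>2)}"

definition time_controls :: "'a control_problem \<Rightarrow> (real \<Rightarrow> real) set" where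
  "time_controls P = {v. set_borel_measurable lborel {0..horizon P} v \<and>
     (\<forall>s\<in>{0..horizon P}. v s \<in> ctrl_set P) \<and>
     set_integrable lborel {0..horizon P} (\<lambda>s. (v s)\<^sup>2)}"

definition deterministic :: "'a control_problem \<Rightarrow> 'a process \<Rightarrow> bool" where
  "deterministic P u \<longleftrightarrow> (\<exists>v\<in>time_controls P. same_control P u (\<lambda>s \<omega>. v s))"

text \<open>
  $\tilde{\mathcal{U}}$, with its second factor embedded in $\mathcal{U}$ as the deterministic controls
\<close>

definition mixed_controls :: "'a control_problem \<Rightarrow> ('a process \<times> 'a process) set" where
  "mixed_controls P = {(u, z). u \<in> controls P \<and> z \<in> controls P \<and> deterministic P z}"

text \<open>
  The constraint $z(s) = \mathbb{E}[u(s)]$ for all $s \in [t,T]$. Since $u$ and $z$ are classes, a pointwise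
  condition at every time is a condition on suitably chosen versions. Integrability of $u(s)$ is required
  because the library's expectation of a non-integrable variable is $0$.
\<close>

definition mean_constraint :: "'a control_problem \<Rightarrow> real \<Rightarrow> 'a process \<Rightarrow> 'a process \<Rightarrow> bool" where
  "mean_constraint P t u z \<longleftrightarrow>
     (\<exists>u'\<in>controls P. \<exists>v\<in>time_controls P.
        same_control P u u' \<and> same_control P z (\<lambda>s \<omega>. v s) \<and>
        (\<forall>s\<in>{t..horizon P}. integrable (prob P) (u' s) \<and> v s = (LINT \<omega>|prob P. u' s \<omega>)))"


section \<open>Hilbert space and operators\<close>

type_synonym hilb = "(real^2) \<times> l2"

definition H_space :: "'a control_problem \<Rightarrow> hilb set" where
  "H_space P = {y. AE \<xi> in lborel. \<xi> \<notin> {- delay P..0} \<longrightarrow> rep_l2 (snd y) \<xi> = 0}"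

text \<open>The library has no exponential on the type of square matrices.\<close>

definition mexp :: "real^'n^'n \<Rightarrow> real^'n^'n" where
  "mexp A = (\<Sum>k. (1 / fact k) *\<^sub>R ((**) A ^^ k) (mat 1))"

definition A0 :: "'a control_problem \<Rightarrow> real^2^2" where
  "A0 P = vector [vector [coef_a0 P, coef_a1 P], vector [0, coef_a0 P + coef_a1 P]]"

text \<open>The semigroup $e^{tA}$ for $t \ge 0$\<close>

definition semigroup_A :: "'a control_problem \<Rightarrow> real \<Rightarrow> hilb \<Rightarrow> hilb" where
  "semigroup_A P t y =
     (mexp (t *\<^sub>R A0 P) *v fst y
        + (LINT s:{- delay P..0}|lborel. indicator {- t..0} s *\<^sub>R
             (mexp ((t + s) *\<^sub>R A0 P) *v rep_l2 (snd y) s)),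
      abs_l2 (\<lambda>\<xi>. indicator {- delay P + t..0} \<xi> *\<^sub>R rep_l2 (snd y) (\<xi> - t)))"

definition op_B :: "'a control_problem \<Rightarrow> real^2 \<Rightarrow> hilb" where
  "op_B P q = (coef_b0 P *\<^sub>R q, abs_l2 (\<lambda>\<xi>. indicator {- delay P..0} \<xi> *\<^sub>R coef_b1 P \<xi> *\<^sub>R q))"

definition op_G :: "'a control_problem \<Rightarrow> real \<Rightarrow> hilb" where
  "op_G P x = (vector [vol P * x, 0], 0)"


section \<open>Wiener integral and state\<close>

text \<open>
  The Ito integral is only needed for deterministic integrands: it is the $L^2(\Omega)$-limit of the
  elementary integrals of step functions converging to the integrand in $L^2([t,s])$. A list of triples
  $(a,b,x)$ stands for the step function $\sum 1_{(a,b]} x$.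
\<close>

definition step_fun :: "(real \<times> real \<times> 'h) list \<Rightarrow> real \<Rightarrow> 'h::real_vector" where
  "step_fun l \<rho> = (\<Sum>(a, b, x)\<leftarrow>l. indicator {a<..b} \<rho> *\<^sub>R x)"

definition step_integral :: "'a process \<Rightarrow> (real \<times> real \<times> 'h) list \<Rightarrow> 'a \<Rightarrow> 'h::real_vector" where
  "step_integral W l \<omega> = (\<Sum>(a, b, x)\<leftarrow>l. (W b \<omega> - W a \<omega>) *\<^sub>R x)"

definition has_wiener_integral ::
  "'a measure \<Rightarrow> 'a process \<Rightarrow> real \<Rightarrow> real \<Rightarrow> (real \<Rightarrow> 'h::real_normed_vector) \<Rightarrow> ('a \<Rightarrow> 'h) \<Rightarrow> bool" where
  "has_wiener_integral M W t s \<phi> X \<longleftrightarrow>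
     X \<in> borel_measurable M \<and>
     (\<exists>l. (\<forall>n. \<forall>(a, b, x)\<in>set (l n). t \<le> a \<and> a \<le> b \<and> b \<le> s) \<and>
        (\<lambda>n. \<integral>\<^sup>+\<rho>\<in>{t..s}. ennreal ((norm (step_fun (l n) \<rho> - \<phi> \<rho>))\<^sup>2) \<partial>lborel) \<longlonglongrightarrow> 0 \<and>
        (\<lambda>n. \<integral>\<^sup>+\<omega>. ennreal ((norm (step_integral W (l n) \<omega> - X \<omega>))\<^sup>2) \<partial>M) \<longlonglongrightarrow> 0)"

definition control_at :: "'a process \<times> 'a process \<Rightarrow> real \<Rightarrow> 'a \<Rightarrow> real^2" where
  "control_at c s \<omega> = vector [fst c s \<omega>, snd c s \<omega>]"

text \<open>
  The operator-valued integrand $e^{(s-\rho)A} G \colon \mathbb{R} \to H$ is identified with its value at $1$.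
  The mild solution is taken in its adapted version with continuous paths, which is unique up to
  indistinguishability.
\<close>

definition is_mild_solution ::
  "'a control_problem \<Rightarrow> real \<Rightarrow> hilb \<Rightarrow> 'a process \<times> 'a process \<Rightarrow> (real \<Rightarrow> 'a \<Rightarrow> hilb) \<Rightarrow> bool" where
  "is_mild_solution P t y c Y \<longleftrightarrow>
     (\<forall>s\<in>{t..horizon P}. Y s \<in> borel_measurable (aug_filtration (prob P) (bm P) s)) \<and>
     (AE \<omega> in prob P. continuous_on {t..horizon P} (\<lambda>s. Y s \<omega>)) \<and>
     (\<forall>s\<in>{t..horizon P}. \<exists>Z.
        has_wiener_integral (prob P) (bm P) t s (\<lambda>\<rho>. semigroup_A P (s - \<rho>) (op_G P 1)) Z \<and>
        (AE \<omega> in prob P. Y s \<omega> = semigroup_A P (s - t) y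
           + (LINT \<rho>:{t..s}|lborel. semigroup_A P (s - \<rho>) (op_B P (control_at c \<rho> \<omega>)))
           + Z \<omega>))"

definition state ::
  "'a control_problem \<Rightarrow> real \<Rightarrow> hilb \<Rightarrow> 'a process \<times> 'a process \<Rightarrow> real \<Rightarrow> 'a \<Rightarrow> hilb" where
  "state P t y c = (SOME Y. is_mild_solution P t y c Y)"


section \<open>Objective and value functions\<close>

text \<open>
  Integral with values in the extended reals. The convention \<open>\<infinity> - \<infinity> = \<infinity>\<close> of the library
  matters only where the integral is not well defined.
\<close>

definition ext_integral :: "'b measure \<Rightarrow> ('b \<Rightarrow> ereal) \<Rightarrow> ereal" where
  "ext_integral N F =
     enn2ereal (\<integral>\<^sup>+x. e2ennreal (F x) \<partial>N) - enn2ereal (\<integral>\<^sup>+x. e2ennreal (- F x) \<partial>N)"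

definition J :: "'a control_problem \<Rightarrow> real \<Rightarrow> hilb \<Rightarrow> 'a process \<times> 'a process \<Rightarrow> ereal" where
  "J P t y c = ext_integral (prob P) (\<lambda>\<omega>.
     ext_integral (restrict_space lborel {t..horizon P})
       (\<lambda>s. ereal (exp (- discount P * (s - t)) *
          running P s (fst (state P t y c s \<omega>) $ 1) (fst (state P t y c s \<omega>) $ 2)
            (control_at c s \<omega> $ 1) (control_at c s \<omega> $ 2)))
     + ereal (exp (- discount P * (horizon P - t)) *
         terminal P (fst (state P t y c (horizon P) \<omega>) $ 1) (fst (state P t y c (horizon P) \<omega>) $ 2)))"

definition mf_admissible :: "'a control_problem \<Rightarrow> real \<Rightarrow> ('a process \<times> 'a process) set" where
  "mf_admissible P t = {(u, z) \<in> mixed_controls P. mean_constraint P t u z}"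

definition diag_admissible :: "'a control_problem \<Rightarrow> ('a process \<times> 'a process) set" where
  "diag_admissible P = {(u, z) \<in> controls P \<times> controls P. same_control P u z}"

definition det_diag_controls :: "'a control_problem \<Rightarrow> ('a process \<times> 'a process) set" where
  "det_diag_controls P =
     {(u, z) \<in> controls P \<times> controls P. same_control P u z \<and> deterministic P u}"

text \<open>The value functions $\mathcal{V}$ (mean-field constraint) and $V$ (constraint $u = z$)\<close>

definition mf_value :: "'a control_problem \<Rightarrow> real \<Rightarrow> hilb \<Rightarrow> ereal" where
  "mf_value P t y = (SUP c\<in>mf_admissible P t. J P t y c)"

definition diag_value :: "'a control_problem \<Rightarrow> real \<Rightarrow> hilb \<Rightarrow> ereal" where
  "diag_value P t y = (SUP c\<in>diag_admissible P. J P t y c)"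

definition mf_optimal :: "'a control_problem \<Rightarrow> real \<Rightarrow> hilb \<Rightarrow> 'a process \<times> 'a process \<Rightarrow> bool" where
  "mf_optimal P t y c \<longleftrightarrow> c \<in> mf_admissible P t \<and> J P t y c = mf_value P t y"

definition diag_optimal :: "'a control_problem \<Rightarrow> real \<Rightarrow> hilb \<Rightarrow> 'a process \<times> 'a process \<Rightarrow> bool" where
  "diag_optimal P t y c \<longleftrightarrow> c \<in> diag_admissible P \<and> J P t y c = diag_value P t y"

end

theory Submission
  imports Defs
begin

text \<open>
  Both problems have the same value, the supremum of the payoff over deterministic pairs with equal
  components, so an admissible pair is optimal for one problem iff it is optimal for the other. What has
  to be shown is that a deterministic diagonal pair is admissible for both. For the problem with
  constraint \<open>u = z\<close> this is immediate. For the mean-field problem the constraint has to hold at every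
  time for suitable versions of \<open>u\<close> and \<open>z\<close>: a function of time alone which represents the control is
  such a version of both, because it is its own expectation; the lemma
  \<open>time_control_is_control\<close> shows that it is a control.
\<close>

text \<open>
  The process factors through the projection to time, so progressive measurability comes from the Borel
  measurability of \<open>v\<close>; square integrability follows by Fubini because a constant is integrable with
  respect to a probability measure.
\<close>

lemma time_control_is_control:
  assumes "prob_space (prob P)" and v: "v \<in> time_controls P"
  shows "(\<lambda>s \<omega>. v s) \<in> controls P"
proof -
  interpret \<Omega>: prob_space "prob P" by fact
  interpret time_\<Omega>: pair_sigma_finite "restrict_space lborel {0..horizon P}" "prob P"
    by (simp add: pair_sigma_finite_def \<Omega>.sigma_finite_measure_axioms
        sigma_finite_measure_restrict_space sigma_finite_lborel)
  have v_meas: "v \<in> borel_measurable (restrict_space lborel {0..horizon P})"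
    using v by (simp add: time_controls_def set_borel_measurable_def borel_measurable_restrict_space_iff)
  have v_int: "integrable (restrict_space lborel {0..horizon P}) (\<lambda>s. (v s)\<^sup>2)"
    using v by (simp add: time_controls_def set_integrable_def integrable_restrict_space)
  have "progressively_measurable (aug_filtration (prob P) (bm P)) (horizon P) (\<lambda>s \<omega>. v s)"
    unfolding progressively_measurable_def
  proof
    fix s assume "s \<in> {0..horizon P}"
    then have sub: "{0..s} \<subseteq> {0..horizon P}" by auto
    have "v \<in> borel_measurable (restrict_space borel {0..horizon P})"
      using v_meas by (simp cong: measurable_cong_sets add: sets_restrict_space)
    then have "v \<in> borel_measurable (restrict_space borel {0..s})"
      by (rule measurable_restrict_mono[OF _ sub])
    then show "(\<lambda>(\<rho>, \<omega>). v \<rho>) \<in> borel_measurable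
        (restrict_space borel {0..s} \<Otimes>\<^sub>M aug_filtration (prob P) (bm P) s)"
      unfolding case_prod_unfold by measurable
  qed
  moreover have "integrable (time_prob P) (\<lambda>(s, \<omega>). (v s)\<^sup>2)"
    unfolding time_prob_def
    by (rule time_\<Omega>.Fubini_integrable)
      (use v_meas v_int in \<open>auto simp: case_prod_unfold \<Omega>.prob_space\<close>)
  ultimately show ?thesis
    using v by (simp add: controls_def time_controls_def)
qed

text \<open>
  A time function \<open>v\<close> representing \<open>u\<close> serves both as the version of \<open>u\<close> and as that of \<open>z\<close>: the
  expectation of the constant \<open>v s\<close> is \<open>v s\<close> at every single time, not only almost everywhere.
\<close>

lemma deterministic_mean_constraint:
  assumes "prob_space (prob P)" "deterministic P u" "same_control P u z"
  shows "mean_constraint P t u z"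
proof -
  interpret \<Omega>: prob_space "prob P" by fact
  obtain v where v: "v \<in> time_controls P" and uv: "same_control P u (\<lambda>s \<omega>. v s)"
    using assms(2) unfolding deterministic_def by blast
  have zv: "same_control P z (\<lambda>s \<omega>. v s)"
    using uv assms(3) unfolding same_control_def by eventually_elim auto
  show ?thesis
    unfolding mean_constraint_def
    using time_control_is_control[OF assms(1) v] v uv zv
    by (intro bexI[of _ "\<lambda>s \<omega>. v s"] bexI[of _ v]) (auto simp: \<Omega>.prob_space)
qed

theorem proposition4p1:
  fixes P :: "'a control_problem" and t :: real and y :: hilb and ustar :: "'a process"
  assumes "standing_assumptions P"
    and "t \<in> {0..horizon P}"
    and "y \<in> H_space P"
    and "mf_value P t y = (SUP c\<in>det_diag_controls P. J P t y c)"
    and "diag_value P t y = (SUP c\<in>det_diag_controls P. J P t y c)"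
    and "ustar \<in> controls P"
    and "deterministic P ustar"
  shows "mf_optimal P t y (ustar, ustar) \<longleftrightarrow> diag_optimal P t y (ustar, ustar)"
proof -
  have prob: "prob_space (prob P)"
    using assms(1) by (simp add: standing_assumptions_def)
  have refl: "same_control P ustar ustar"
    by (simp add: same_control_def)
  have "(ustar, ustar) \<in> mf_admissible P t"
    using assms(6,7) deterministic_mean_constraint[OF prob assms(7) refl]
    by (simp add: mf_admissible_def mixed_controls_def)
  moreover have "(ustar, ustar) \<in> diag_admissible P"
    using assms(6) refl by (simp add: diag_admissible_def)
  ultimately show ?thesis
    using assms(4,5) by (simp add: mf_optimal_def diag_optimal_def)
qed

end
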